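(* Let $n\ge2$, assume $\alpha>8$, and let $(\kappa_i,u_i)_{i=0}^3$ be a feasible four-size profile, so $u_i=\alpha-2-i$ and $\sum_{i=0}^3\kappa_iu_i=n$. Then every feasible endpoint table $L=(\ell_{ij})_{0\le i,j\le3}$, with row margins $r=(r_i)$ and column margins $c=(c_j)$, satisfies $$W(L)^2\le\bigl(D(r)A_LQ^L\bigr)\bigl(D(c)C_LQ^L\bigr).$$
   Context: Let $\alpha:=\lfloor 2\log_2 n-2\log_2\log_2 n+2\log_2(\mathrm e/2)+1\rfloor$. The $\kappa_i$ are nonnegative integers. $(x)_r=x(x-1)\cdots(x-r+1)$ is the falling factorial ($=0$ if $r>x$); $g(0)=g(1)=g(2)=1$, $g(x)=2^{\binom x2-1}$ for $x\ge3$. A table $L=(\ell_{ij})\in\mathbb N_0^{4\times4}$ has margins $r_i=\sum_j\ell_{ij}$, $c_j=\sum_i\ell_{ij}$, and is feasible if $r_i\le\kappa_i$ and $c_j\le\kappa_j$ for all $i,j$. Put $x_{ij}=\min\{u_i,u_j\}$, $J(L)=\sum_{i,j}x_{ij}\ell_{ij}$, and $$W(L)=\frac{\prod_i(\kappa_i)_{r_i}\prod_j(\kappa_j)_{c_j}}{\prod_{i,j}\ell_{ij}!}\,\frac1{(n)_{J(L)}}\prod_{i,j}\left[\frac{(u_i)_{x_{ij}}(u_j)_{x_{ij}}}{x_{ij}!}g(x_{ij})\right]^{\ell_{ij}}.$$ For integer vectors $v=(v_i)_{i=0}^3$ with $0\le v_i\le\kappa_i$, $$D(v)=\frac{\prod_i(\kappa_i)_{v_i}^2}{\prod_iv_i!}\,\frac{\prod_i[u_i!\,g(u_i)]^{v_i}}{(n)_{m(v)}},\qquad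 m(v)=\sum_iu_iv_i.$$ With $s_{ij}=\min\{u_i,u_j\}$, $t_{ij}=\max\{u_i,u_j\}$, $d_{ij}=t_{ij}-s_{ij}$, $$Q_{ij}:=(n+1)^{d_{ij}/2}\frac{\sqrt{(t_{ij})_{d_{ij}}}}{d_{ij}!}2^{-\{d_{ij}s_{ij}+\binom{d_{ij}}2\}/2}.$$ Finally $A_L=\prod_ir_i!/\prod_{i,j}\ell_{ij}!$, $C_L=\prod_jc_j!/\prod_{i,j}\ell_{ij}!$, $Q^L=\prod_{i,j}Q_{ij}^{\ell_{ij}}$. *)

theory Defs
  imports Complex_Main
begin

text \<open>
  Profiles, tables and vectors are functions on \<^typ>\<open>nat\<close>; only the indices
  below 4 are ever used.
\<close>

definition alpha :: "nat \<Rightarrow> int" where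
  "alpha n = \<lfloor>2 * log 2 (real n) - 2 * log 2 (log 2 (real n)) + 2 * log 2 (exp 1 / 2) + 1\<rfloor>"

text \<open>The factor with \<open>i = x\<close> makes this vanish for \<open>r > x\<close>.\<close>
definition ffact :: "nat \<Rightarrow> nat \<Rightarrow> real" where
  "ffact x r = (\<Prod>i<r. (real x - real i))"

definition g :: "nat \<Rightarrow> real" where
  "g x = (if x \<le> 2 then 1 else 2 ^ ((x choose 2) - 1))"

definition four_size_profile :: "nat \<Rightarrow> (nat \<Rightarrow> nat) \<Rightarrow> (nat \<Rightarrow> nat) \<Rightarrow> bool" where
  "four_size_profile n \<kappa> u \<longleftrightarrow>
     (\<forall>i<4. int (u i) = alpha n - 2 - int i) \<and> (\<Sum>i<4. \<kappa> i * u i) = n"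

definition row_margin :: "(nat \<Rightarrow> nat \<Rightarrow> nat) \<Rightarrow> nat \<Rightarrow> nat" where
  "row_margin L i = (\<Sum>j<4. L i j)"

definition col_margin :: "(nat \<Rightarrow> nat \<Rightarrow> nat) \<Rightarrow> nat \<Rightarrow> nat" where
  "col_margin L j = (\<Sum>i<4. L i j)"

definition feasible_table :: "(nat \<Rightarrow> nat) \<Rightarrow> (nat \<Rightarrow> nat \<Rightarrow> nat) \<Rightarrow> bool" where
  "feasible_table \<kappa> L \<longleftrightarrow> (\<forall>i<4. row_margin L i \<le> \<kappa> i) \<and> (\<forall>j<4. col_margin L j \<le> \<kappa> j)"

definition overlap :: "(nat \<Rightarrow> nat) \<Rightarrow> nat \<Rightarrow> nat \<Rightarrow> nat" where
  "overlap u i j = min (u i) (u j)"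

definition J :: "(nat \<Rightarrow> nat) \<Rightarrow> (nat \<Rightarrow> nat \<Rightarrow> nat) \<Rightarrow> nat" where
  "J u L = (\<Sum>i<4. \<Sum>j<4. overlap u i j * L i j)"

definition W :: "nat \<Rightarrow> (nat \<Rightarrow> nat) \<Rightarrow> (nat \<Rightarrow> nat) \<Rightarrow> (nat \<Rightarrow> nat \<Rightarrow> nat) \<Rightarrow> real" where
  "W n \<kappa> u L =
     ((\<Prod>i<4. ffact (\<kappa> i) (row_margin L i)) * (\<Prod>j<4. ffact (\<kappa> j) (col_margin L j)))
       / (\<Prod>i<4. \<Prod>j<4. fact (L i j))
     * (1 / ffact n (J u L))
     * (\<Prod>i<4. \<Prod>j<4.
          (ffact (u i) (overlap u i j) * ffact (u j) (overlap u i j) / fact (overlap u i j)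
             * g (overlap u i j)) ^ L i j)"

definition m :: "(nat \<Rightarrow> nat) \<Rightarrow> (nat \<Rightarrow> nat) \<Rightarrow> nat" where
  "m u v = (\<Sum>i<4. u i * v i)"

definition D :: "nat \<Rightarrow> (nat \<Rightarrow> nat) \<Rightarrow> (nat \<Rightarrow> nat) \<Rightarrow> (nat \<Rightarrow> nat) \<Rightarrow> real" where
  "D n \<kappa> u v =
     (\<Prod>i<4. (ffact (\<kappa> i) (v i))\<^sup>2) / (\<Prod>i<4. fact (v i))
     * ((\<Prod>i<4. (fact (u i) * g (u i)) ^ v i) / ffact n (m u v))"

definition Q :: "nat \<Rightarrow> (nat \<Rightarrow> nat) \<Rightarrow> nat \<Rightarrow> nat \<Rightarrow> real" where
  "Q n u i j =
     (let s = min (u i) (u j); t = max (u i) (u j); d = t - s in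
        (real n + 1) powr (real d / 2) * (sqrt (ffact t d) / fact d)
        * 2 powr (- (real (d * s + (d choose 2)) / 2)))"

definition A_coeff :: "(nat \<Rightarrow> nat \<Rightarrow> nat) \<Rightarrow> real" where
  "A_coeff L = (\<Prod>i<4. fact (row_margin L i)) / (\<Prod>i<4. \<Prod>j<4. fact (L i j))"

definition C_coeff :: "(nat \<Rightarrow> nat \<Rightarrow> nat) \<Rightarrow> real" where
  "C_coeff L = (\<Prod>j<4. fact (col_margin L j)) / (\<Prod>i<4. \<Prod>j<4. fact (L i j))"

definition Q_pow :: "nat \<Rightarrow> (nat \<Rightarrow> nat) \<Rightarrow> (nat \<Rightarrow> nat \<Rightarrow> nat) \<Rightarrow> real" where
  "Q_pow n u L = (\<Prod>i<4. \<Prod>j<4. Q n u i j ^ L i j)"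

end

theory Submission
  imports Defs
begin

text \<open>
  All factors depending only on \<open>\<kappa>\<close> and the factorials cancel. Cell by cell, the squared weight in
  \<open>W\<close> times \<open>(n + 1)\<^bsup>d\<^esup>\<close> with \<open>d = \<bar>u\<^sub>i - u\<^sub>j\<bar>\<close> equals
  \<open>u\<^sub>i! g(u\<^sub>i) u\<^sub>j! g(u\<^sub>j) Q\<^sub>i\<^sub>j\<^sup>2\<close>, the powers of 2 in \<open>Q\<close> being exactly the ratio of the two values
  of \<open>g\<close> because all sizes are at least 3. What remains is
  \<open>(n)\<^bsub>m(r)\<^esub> (n)\<^bsub>m(c)\<^esub> \<le> (n)\<^bsub>J\<^esub>\<^sup>2 (n + 1)\<^bsup>m(r) + m(c) - 2J\<^esup>\<close>, where
  feasibility gives \<open>J \<le> m(r), m(c) \<le> n\<close>.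
\<close>

lemma ffact_pos: "r \<le> x \<Longrightarrow> 0 < ffact x r"
  unfolding ffact_def by (intro prod_pos) auto

lemma ffact_mult_fact: "ffact (r + k) r * fact k = fact (r + k)"
proof (induction r arbitrary: k)
  case 0
  then show ?case by (simp add: ffact_def)
next
  case (Suc r)
  \<comment> \<open>The last factor of the falling factorial is \<open>k + 1\<close>, which turns
    \<open>fact k\<close> into \<open>fact (Suc k)\<close>; hence \<open>k\<close> is kept
    arbitrary.\<close>
  have "ffact (Suc r + k) (Suc r) * fact k = ffact (r + Suc k) r * fact (Suc k)"
    by (simp add: ffact_def algebra_simps)
  also have "\<dots> = fact (Suc r + k)"
    using Suc.IH[of "Suc k"] by simp
  finally show ?case .
qed

text \<open>Each of the \<open>k\<close> extra factors is at most \<open>n + 1\<close>, and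
  \<open>a + k \<le> n\<close> keeps all factors nonnegative, so the bounds multiply.\<close>

lemma ffact_add_le:
  assumes "a + k \<le> n"
  shows "ffact n (a + k) \<le> ffact n a * (real n + 1) ^ k"
  using assms
proof (induction k)
  case (Suc k)
  have "ffact n (a + Suc k) = ffact n (a + k) * (real n - real (a + k))"
    by (simp add: ffact_def)
  also have "\<dots> \<le> (ffact n a * (real n + 1) ^ k) * (real n + 1)"
    using Suc ffact_pos[of a n] by (intro mult_mono) (auto simp: less_imp_le)
  finally show ?case by (simp add: mult_ac)
qed simp

text \<open>Pairs in a disjoint union of an \<open>s\<close>-set and a \<open>d\<close>-set lie in
  one of the two sets or join them.\<close>

lemma choose_two_add: "(s + d) choose 2 = (s choose 2) + d * s + (d choose 2)"
  by (induction d) (simp_all add: numeral_2_eq_2)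

lemma g_add:
  assumes "3 \<le> s"
  shows "g (s + d) = g s * 2 ^ (d * s + (d choose 2))"
proof -
  \<comment> \<open>The exponent of \<open>g\<close> is a truncated subtraction; positivity allows
    the \<open>- 1\<close> to stay with \<open>s choose 2\<close>.\<close>
  have "0 < s choose 2"
    using assms by (intro zero_less_binomial) simp
  then have "((s + d) choose 2) - 1 = ((s choose 2) - 1) + (d * s + (d choose 2))"
    unfolding choose_two_add by linarith
  then show ?thesis
    using assms by (simp add: g_def power_add)
qed

lemma Q_commute: "Q n u i j = Q n u j i"
  by (simp add: Q_def min.commute max.commute)

text \<open>Squaring clears the half exponents and the square root, leaving only natural powers and
  factorial quotients.\<close>

lemma Q_square:
  assumes "u j = u i + d"
  shows "(Q n u i j)\<^sup>2 =
    (real n + 1) ^ d * (ffact (u i + d) d / (fact d)\<^sup>2) / 2 ^ (d * u i + (d choose 2))"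
proof -
  have half: "(x powr (y / 2))\<^sup>2 = x powr y" for x y :: real
    by (simp add: power2_eq_square flip: powr_add)
  have "(2 powr (- (real (d * u i + (d choose 2)) / 2)))\<^sup>2
      = (2::real) powr (- real (d * u i + (d choose 2)))"
    using half[of 2 "- real (d * u i + (d choose 2))"] by (simp only: minus_divide_left)
  also have "\<dots> = 1 / 2 ^ (d * u i + (d choose 2))"
    by (simp only: powr_minus powr_realpow zero_less_numeral inverse_eq_divide)
  finally have two: "(2 powr (- (real (d * u i + (d choose 2)) / 2)))\<^sup>2
      = 1 / (2::real) ^ (d * u i + (d choose 2))" .
  have "((real n + 1) powr (real d / 2))\<^sup>2 = (real n + 1) ^ d"
    by (simp only: half) (simp add: powr_realpow)
  moreover have "(sqrt (ffact (u i + d) d))\<^sup>2 = ffact (u i + d) d"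
    using ffact_pos[of d "u i + d"] by simp
  moreover have "Q n u i j = (real n + 1) powr (real d / 2) * (sqrt (ffact (u i + d) d) / fact d)
      * 2 powr (- (real (d * u i + (d choose 2)) / 2))"
    using assms by (simp add: Q_def Let_def)
  ultimately show ?thesis
    by (simp add: power_mult_distrib power_divide two del: of_nat_add of_nat_mult)
qed

text \<open>The base of the power \<open>L i j\<close> in \<open>W\<close>.\<close>

definition cell_weight :: "(nat \<Rightarrow> nat) \<Rightarrow> nat \<Rightarrow> nat \<Rightarrow> real" where
  "cell_weight u i j = ffact (u i) (overlap u i j) * ffact (u j) (overlap u i j)
     / fact (overlap u i j) * g (overlap u i j)"

text \<open>With \<open>s = u i\<close> and \<open>u j = s + d\<close> the weight is
  \<open>fact (s + d) / fact d * g s\<close>. In its square, one \<open>fact (s + d)\<close> is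
  split as \<open>fact s * ffact (s + d) d\<close> and one \<open>g s\<close> is traded for
  \<open>g (s + d)\<close> over a power of 2; both corrections are absorbed by
  \<open>Q_square\<close>.\<close>

lemma cell_weight_square_ordered:
  assumes "3 \<le> u i" "u i \<le> u j"
  shows "(cell_weight u i j)\<^sup>2 * (real n + 1) ^ (max (u i) (u j) - min (u i) (u j)) =
    (fact (u i) * g (u i)) * (fact (u j) * g (u j)) * (Q n u i j)\<^sup>2"
proof -
  obtain d where d: "u j = u i + d" using assms(2) le_Suc_ex by blast
  define s where "s = u i"
  have "ffact s s = fact s"
    using ffact_mult_fact[of s 0] by simp
  moreover have "ffact (s + d) s = fact (s + d) / fact d"
    using ffact_mult_fact[of s d] by (simp add: field_simps)
  ultimately have "cell_weight u i j = fact (s + d) / fact d * g s"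
    by (simp add: cell_weight_def overlap_def d flip: s_def)
  moreover have "fact s * ffact (s + d) d = fact (s + d)"
    using ffact_mult_fact[of d s] by (simp add: ac_simps)
  moreover have "g (s + d) = g s * 2 ^ (d * s + (d choose 2))"
    using assms(1) by (intro g_add) (simp add: s_def)
  moreover have "(Q n u i j)\<^sup>2 =
      (real n + 1) ^ d * (ffact (s + d) d / (fact d)\<^sup>2) / 2 ^ (d * s + (d choose 2))"
    unfolding s_def using d by (rule Q_square)
  ultimately show ?thesis
    by (simp add: d power_divide power_mult_distrib power2_eq_square flip: s_def)
qed

lemma cell_weight_square:
  assumes "3 \<le> u i" "3 \<le> u j"
  shows "(cell_weight u i j)\<^sup>2 * (real n + 1) ^ (max (u i) (u j) - min (u i) (u j)) =
    (fact (u i) * g (u i)) * (fact (u j) * g (u j)) * (Q n u i j)\<^sup>2"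
proof (cases "u i \<le> u j")
  case True
  with assms show ?thesis by (intro cell_weight_square_ordered)
next
  case False
  have "cell_weight u i j = cell_weight u j i"
    by (simp add: cell_weight_def overlap_def min.commute mult_ac)
  with cell_weight_square_ordered[of u j i n] assms False show ?thesis
    by (simp add: Q_commute[of n u i j] min.commute max.commute mult_ac)
qed

lemma m_row_margin: "m u (row_margin L) = (\<Sum>i<4. \<Sum>j<4. u i * L i j)"
  by (simp add: m_def row_margin_def sum_distrib_left)

lemma m_col_margin: "m u (col_margin L) = (\<Sum>i<4. \<Sum>j<4. u j * L i j)"
  unfolding m_def col_margin_def sum_distrib_left by (rule sum.swap)

lemma prod_power_row_margin:
  fixes x :: "nat \<Rightarrow> real"
  shows "(\<Prod>i<4. x i ^ row_margin L i) = (\<Prod>i<4. \<Prod>j<4. x i ^ L i j)"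
  by (simp add: row_margin_def power_sum)

lemma prod_power_col_margin:
  fixes x :: "nat \<Rightarrow> real"
  shows "(\<Prod>j<4. x j ^ col_margin L j) = (\<Prod>i<4. \<Prod>j<4. x j ^ L i j)"
  unfolding col_margin_def power_sum by (rule prod.swap)

theorem lemma8p7:
  fixes n :: nat and \<kappa> u :: "nat \<Rightarrow> nat" and L :: "nat \<Rightarrow> nat \<Rightarrow> nat"
  assumes "n \<ge> 2"
    and "alpha n > 8"
    and "four_size_profile n \<kappa> u"
    and "feasible_table \<kappa> L"
  shows "(W n \<kappa> u L)\<^sup>2 \<le>
      (D n \<kappa> u (row_margin L) * A_coeff L * Q_pow n u L) *
      (D n \<kappa> u (col_margin L) * C_coeff L * Q_pow n u L)"
proof -
  \<comment> \<open>Since \<open>alpha n \<ge> 9\<close>, even the smallest size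
    \<open>u 3 = alpha n - 5\<close> is at least 4.\<close>
  have u3: "3 \<le> u i" if "i < 4" for i
  proof -
    have "int (u i) = alpha n - 2 - int i"
      using assms(3) that by (simp add: four_size_profile_def)
    with assms(2) that show ?thesis by linarith
  qed
  have size: "(\<Sum>i<4. \<kappa> i * u i) = n"
    using assms(3) by (simp add: four_size_profile_def)
  have m_le: "m u v \<le> n" if "\<And>i. i < 4 \<Longrightarrow> v i \<le> \<kappa> i" for v
    unfolding m_def size[symmetric] using that
    by (intro sum_mono) (simp add: mult.commute)
  have r_le: "m u (row_margin L) \<le> n" and c_le: "m u (col_margin L) \<le> n"
    using assms(4) by (auto simp: feasible_table_def intro!: m_le)

  define w where "w i j = cell_weight u i j" for i j
  define x where "x i = fact (u i) * g (u i)" for i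
  define d where "d i j = max (u i) (u j) - min (u i) (u j)" for i j
  define E where "E = (\<Sum>i<4. \<Sum>j<4. d i j * L i j)"
  define P where "P = (\<Prod>i<4. \<Prod>j<4. w i j ^ L i j)"
  define F :: real where "F = (\<Prod>i<4. \<Prod>j<4. fact (L i j))"
  define R where "R = (\<Prod>i<4. ffact (\<kappa> i) (row_margin L i))"
  define C where "C = (\<Prod>j<4. ffact (\<kappa> j) (col_margin L j))"
  define X where "X = (\<Prod>i<4. x i ^ row_margin L i)"
  define Y where "Y = (\<Prod>j<4. x j ^ col_margin L j)"
  define fr where "fr = ffact n (m u (row_margin L))"
  define fc where "fc = ffact n (m u (col_margin L))"
  define fJ where "fJ = ffact n (J u L)"

  have J_r: "J u L \<le> m u (row_margin L)" and J_c: "J u L \<le> m u (col_margin L)"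
    unfolding J_def overlap_def m_row_margin m_col_margin
    by (intro sum_mono mult_right_mono; simp)+
  \<comment> \<open>Cellwise, \<open>u i + u j\<close> is twice the minimum plus the gap
    \<open>d i j\<close>.\<close>
  have "m u (row_margin L) + m u (col_margin L) = J u L + J u L + E"
    unfolding J_def overlap_def m_row_margin m_col_margin E_def sum.distrib[symmetric] d_def
    by (intro sum.cong refl) (auto simp: min_def max_def simp flip: add_mult_distrib)
  then have E_eq: "E = (m u (row_margin L) - J u L) + (m u (col_margin L) - J u L)"
    using J_r J_c by linarith
  have pos: "0 < fr" "0 < fc" "0 < fJ"
    using r_le c_le J_r by (auto simp: fr_def fc_def fJ_def intro!: ffact_pos)
  have "fr * fc \<le> (fJ * (real n + 1) ^ (m u (row_margin L) - J u L))
      * (fJ * (real n + 1) ^ (m u (col_margin L) - J u L))"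
  proof (rule mult_mono)
    show "fr \<le> fJ * (real n + 1) ^ (m u (row_margin L) - J u L)"
      using ffact_add_le[of "J u L" "m u (row_margin L) - J u L" n] J_r r_le
      by (simp add: fr_def fJ_def)
    show "fc \<le> fJ * (real n + 1) ^ (m u (col_margin L) - J u L)"
      using ffact_add_le[of "J u L" "m u (col_margin L) - J u L" n] J_c c_le
      by (simp add: fc_def fJ_def)
  qed (use pos in auto)
  then have key: "fr * fc \<le> fJ\<^sup>2 * (real n + 1) ^ E"
    by (simp add: E_eq power_add power2_eq_square mult_ac)

  \<comment> \<open>The total gap \<open>E\<close> is distributed over the cells, so that the
    identity for a single cell applies to each base.\<close>
  have "P\<^sup>2 * (real n + 1) ^ E
      = (\<Prod>i<4. \<Prod>j<4. ((w i j)\<^sup>2 * (real n + 1) ^ d i j) ^ L i j)"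
    by (simp add: P_def E_def power_sum power_mult power_mult_distrib prod.distrib
        prod_power_distrib power_commutes flip: power_mult) (simp add: mult.commute)
  also have "\<dots> = (\<Prod>i<4. \<Prod>j<4. (x i * x j * (Q n u i j)\<^sup>2) ^ L i j)"
    using u3 by (intro prod.cong refl) (simp add: w_def d_def x_def cell_weight_square)
  also have "\<dots> = X * Y * (Q_pow n u L)\<^sup>2"
    unfolding X_def Y_def prod_power_row_margin prod_power_col_margin Q_pow_def
    by (simp add: power_mult_distrib prod.distrib power2_eq_square)
  finally have cells: "P\<^sup>2 * (real n + 1) ^ E = X * Y * (Q_pow n u L)\<^sup>2" .

  have W_eq: "W n \<kappa> u L = R * C / F * (1 / fJ) * P"
    by (simp add: W_def R_def C_def F_def fJ_def P_def w_def cell_weight_def)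
  \<comment> \<open>The margin factorials in the denominator of \<open>D\<close> cancel the
    numerator of \<open>A_coeff\<close>.\<close>
  have DA: "D n \<kappa> u (row_margin L) * A_coeff L = R\<^sup>2 / F * (X / fr)"
    by (simp add: D_def A_coeff_def R_def X_def x_def fr_def F_def prod_power_distrib)
  have DC: "D n \<kappa> u (col_margin L) * C_coeff L = C\<^sup>2 / F * (Y / fc)"
    by (simp add: D_def C_coeff_def C_def Y_def x_def fc_def F_def prod_power_distrib)
  have "1 / fJ\<^sup>2 \<le> (real n + 1) ^ E / (fr * fc)"
    using key pos by (simp add: field_simps)
  \<comment> \<open>The multiplier is a square, so no signs of \<open>R\<close>, \<open>C\<close>,
    \<open>P\<close> have to be checked.\<close>
  then have "(R * C * P / F)\<^sup>2 * (1 / fJ\<^sup>2) \<le> (R * C * P / F)\<^sup>2 * ((real n + 1) ^ E / (fr * fc))"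
    by (intro mult_left_mono) auto
  also have "\<dots> = (R * C / F)\<^sup>2 * (P\<^sup>2 * (real n + 1) ^ E) / (fr * fc)"
    by (simp add: power_mult_distrib power_divide)
  also have "\<dots> = (R\<^sup>2 / F * (X / fr) * Q_pow n u L) * (C\<^sup>2 / F * (Y / fc) * Q_pow n u L)"
    unfolding cells by (simp add: power_mult_distrib power_divide power2_eq_square mult_ac)
  finally show ?thesis
    unfolding DA DC W_eq by (simp add: power_mult_distrib power_divide)
qed

end
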